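(* Let $\mathcal{X},\mathcal{Y}$ be finite alphabets. For any joint distribution $P_{XY}$ on $\mathcal{X}\times\mathcal{Y}$, the maximal realizable leakage from $X$ to $Y$ is given by the Rényi divergence of order infinity: $$\mathcal{L}^r(X\to Y)=\max_{\substack{(x,y)\in\mathcal{X}\times\mathcal{Y}\\P_{XY}(x,y)>0}}\log\frac{P_{Y|X}(y|x)}{P_Y(y)}=D_\infty(P_{XY}\|P_X\times P_Y).$$
   Context: $\log$ is the natural logarithm. The maximal realizable leakage from $X$ to $Y$ is $$\mathcal{L}^r(X\to Y)=\sup_{U:\,U-X-Y}\log\frac{\max_{y\in\mathrm{supp}(Y)}\max_{u\in\mathcal{U}}P_{U|Y}(u|y)}{\max_{u\in\mathcal{U}}P_U(u)},$$ where $U-X-Y$ denotes a Markov chain, the alphabet $\mathcal{U}$ of $U$ is finite but of arbitrary size, and $\mathrm{supp}(Y)=\{y:P_Y(y)>0\}$. $D_\infty(P\|Q)=\log\sup_{a:\,P(a)>0}\frac{P(a)}{Q(a)}$. *)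

theory Defs
  imports "HOL-Probability.Probability"
begin

definition log_ennreal :: "ennreal \<Rightarrow> ereal" where
  "log_ennreal r = (if r = 0 then - \<infinity> else if r = \<infinity> then \<infinity> else ereal (ln (enn2real r)))"

text \<open>
  The quotient is taken in \<^typ>\<open>ennreal\<close>, where a positive number divided by \<open>0\<close> is \<open>\<infinity>\<close>,
  so the divergence is \<open>\<infinity>\<close> when \<open>P\<close> is not absolutely continuous with respect to \<open>Q\<close>.
\<close>
definition renyi_divergence_infinity :: "'a pmf \<Rightarrow> 'a pmf \<Rightarrow> ereal" where
  "renyi_divergence_infinity P Q =
     log_ennreal (SUP a \<in> {a. pmf P a > 0}. ennreal (pmf P a) / ennreal (pmf Q a))"

text \<open>\<open>U - X - Y\<close> for discrete random variables on the probability space \<open>W\<close>: \<open>U\<close> and \<open>Y\<close> are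
  conditionally independent given \<open>X\<close>.\<close>
definition markov_chain ::
  "'w pmf \<Rightarrow> ('w \<Rightarrow> 'u) \<Rightarrow> ('w \<Rightarrow> 'x) \<Rightarrow> ('w \<Rightarrow> 'y) \<Rightarrow> bool" where
  "markov_chain W U X Y \<longleftrightarrow>
     (\<forall>u x y. \<P>(w in measure_pmf W. X w = x) > 0 \<longrightarrow>
        \<P>(w in measure_pmf W. U w = u \<and> Y w = y \<bar> X w = x) =
        \<P>(w in measure_pmf W. U w = u \<bar> X w = x) * \<P>(w in measure_pmf W. Y w = y \<bar> X w = x))"

text \<open>
  The variables \<open>U\<close> admitted in the supremum are given by their finite alphabet \<open>A\<close> and by the joint
  distribution \<open>W\<close> of \<open>(U, X, Y)\<close>, whose \<open>(X, Y)\<close>-marginal has to be \<open>P\<close>. As every finite alphabet is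
  in bijection with a set of natural numbers, it suffices to let \<open>A\<close> range over finite sets of
  naturals.
\<close>
definition realizations :: "('x \<times> 'y) pmf \<Rightarrow> (nat set \<times> (nat \<times> 'x \<times> 'y) pmf) set" where
  "realizations P = {(A, W). finite A \<and> fst ` set_pmf W \<subseteq> A \<and> map_pmf snd W = P \<and>
     markov_chain W fst (\<lambda>(u, x, y). x) (\<lambda>(u, x, y). y)}"

text \<open>
  The logarithms are real: both maxima are positive, because \<open>P\<^sub>U\<close> and each \<open>P\<^sub>U\<^sub>|\<^sub>Y\<close> with
  \<open>P\<^sub>Y(y) > 0\<close> are distributions on the finite set \<open>A\<close>. The supremum is taken in \<^typ>\<open>ereal\<close>, so that
  it exists without assuming boundedness.
\<close>
definition maximal_realizable_leakage :: "('x::finite \<times> 'y::finite) pmf \<Rightarrow> ereal" where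
  "maximal_realizable_leakage P =
     (SUP (A, W) \<in> realizations P. ereal (ln (
        (MAX y \<in> {y. pmf (map_pmf snd P) y > 0}.
           MAX u \<in> A. \<P>((u', x', y') in measure_pmf W. u' = u \<bar> y' = y)) /
        (MAX u \<in> A. pmf (map_pmf fst W) u))))"

end

theory Submission
  imports Defs
begin

text \<open>
  Let \<open>M\<close> be the maximum of \<open>P(x,y) / (P(x) P(y))\<close>, attained at \<open>(x\<^sub>0, y\<^sub>0)\<close>. For a Markov chain,
  \<open>P(u,x,y) = P(u,x) P(x,y) / P(x) \<le> M P(u,x) P(y)\<close>; summation over \<open>x\<close> gives
  \<open>P(u|y) \<le> M P(u)\<close>, so the leakage is at most \<open>ln M\<close>. The bound is attained by the variable \<open>U\<close>
  that is \<open>0\<close> when \<open>X = x\<^sub>0\<close> and otherwise uniform on \<open>{1..n}\<close>, where \<open>n\<close> is so large that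
  \<open>1 / n \<le> P(x\<^sub>0)\<close>: then \<open>0\<close> is the most likely value of \<open>U\<close>, and
  \<open>P(U = 0|y\<^sub>0) / P(U = 0) = P(x\<^sub>0|y\<^sub>0) / P(x\<^sub>0) = M\<close>.
\<close>

section \<open>Upper bound for an arbitrary Markov chain\<close>

lemma cond_prob_pair_pmf:
  "\<P>((x', y') in measure_pmf P. y' = y \<bar> x' = x) = pmf P (x, y) / pmf (map_pmf fst P) x"
proof -
  have "{w. snd w = y \<and> fst w = x} = {(x, y)}" by auto
  then show ?thesis
    by (simp add: cond_prob_def case_prod_beta pmf_map measure_pmf_single vimage_def)
qed

lemma cond_prob_fst_thd_pmf:
  "\<P>((u', x', y') in measure_pmf W. u' = u \<bar> y' = y) =
     measure_pmf.prob W {w. fst w = u \<and> snd (snd w) = y} / pmf (map_pmf snd (map_pmf snd W)) y"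
  by (simp add: cond_prob_def case_prod_beta pmf_map pmf.map_comp o_def vimage_def)

text \<open>Conditional independence factors \<open>P(u,x,y)\<close> as
  \<open>P(u,x) P(x,y) / P(x)\<close>, and \<open>le\<close> bounds the last quotient by
  \<open>M P(y)\<close>. The product form keeps the bound meaningful when \<open>P(x)\<close> or
  \<open>P(y)\<close> vanishes.\<close>

lemma markov_chain_pmf_le:
  assumes marg: "map_pmf snd W = P"
    and markov: "markov_chain W fst (\<lambda>(u, x, y). x) (\<lambda>(u, x, y). y)"
    and le: "pmf P (x, y) \<le> M * (pmf (map_pmf fst P) x * pmf (map_pmf snd P) y)"
  shows "pmf W (u, x, y) \<le>
    M * pmf (map_pmf snd P) y * measure_pmf.prob W {w. fst w = u \<and> fst (snd w) = x}"
proof -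
  have X: "measure_pmf.prob W {w. fst (snd w) = x} = pmf (map_pmf fst P) x"
    unfolding marg[symmetric] pmf_map
    by (simp add: vimage_def)
  have XY: "measure_pmf.prob W {w. snd (snd w) = y \<and> fst (snd w) = x} = pmf P (x, y)"
    unfolding marg[symmetric] pmf_map
    by (rule arg_cong[where f = "measure_pmf.prob W"]) auto
  have UXY: "{w. fst w = u \<and> snd (snd w) = y \<and> fst (snd w) = x} = {(u, x, y)}"
    by auto
  show ?thesis
  proof (cases "pmf (map_pmf fst P) x = 0")
    \<comment> \<open>Here \<open>markov\<close> says nothing about \<open>x\<close>; both sides
      vanish because their events lie in the null event \<open>X = x\<close>.\<close>
    case True
    have "pmf W (u, x, y) = measure_pmf.prob W {(u, x, y)}"
      by (simp add: measure_pmf_single)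
    also have "\<dots> \<le> measure_pmf.prob W {w. fst (snd w) = x}"
      by (rule measure_pmf.finite_measure_mono) auto
    finally have "pmf W (u, x, y) = 0"
      using X True by simp
    moreover have "measure_pmf.prob W {w. fst w = u \<and> fst (snd w) = x}
        \<le> measure_pmf.prob W {w. fst (snd w) = x}"
      by (rule measure_pmf.finite_measure_mono) auto
    then have "measure_pmf.prob W {w. fst w = u \<and> fst (snd w) = x} = 0"
      using X True by (simp add: measure_le_0_iff)
    ultimately show ?thesis by simp
  next
    case False
    then have pos: "pmf (map_pmf fst P) x > 0"
      by (simp add: pmf_pos)
    let ?q = "measure_pmf.prob W {w. fst w = u \<and> fst (snd w) = x}"
    have "pmf W (u, x, y) / pmf (map_pmf fst P) x =
        (?q / pmf (map_pmf fst P) x) * (pmf P (x, y) / pmf (map_pmf fst P) x)"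
      using markov[unfolded markov_chain_def, rule_format, of x u y] pos
      by (simp add: cond_prob_def case_prod_beta X XY UXY measure_pmf_single)
    then have "pmf W (u, x, y) = ?q * (pmf P (x, y) / pmf (map_pmf fst P) x)"
      using pos by (simp add: field_simps)
    also have "\<dots> \<le> ?q * (M * pmf (map_pmf snd P) y)"
      using pos le by (intro mult_left_mono) (simp_all add: field_simps)
    finally show ?thesis by (simp add: mult_ac)
  qed
qed

lemma markov_chain_prob_le:
  fixes P :: "('x::finite \<times> 'y) pmf"
  assumes marg: "map_pmf snd W = P"
    and markov: "markov_chain W fst (\<lambda>(u, x, y). x) (\<lambda>(u, x, y). y)"
    and le: "\<And>x. pmf P (x, y) \<le> M * (pmf (map_pmf fst P) x * pmf (map_pmf snd P) y)"
  shows "measure_pmf.prob W {w. fst w = u \<and> snd (snd w) = y} \<le>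
    M * pmf (map_pmf snd P) y * pmf (map_pmf fst W) u"
proof -
  have "{w. fst w = u \<and> snd (snd w) = y} = (\<lambda>x::'x. (u, x, y)) ` UNIV"
    by (auto simp: image_iff)
  then have "measure_pmf.prob W {w. fst w = u \<and> snd (snd w) = y} = (\<Sum>x\<in>UNIV. pmf W (u, x, y))"
    by (simp add: measure_measure_pmf_finite sum.reindex inj_on_def)
  also have "\<dots> \<le> (\<Sum>x\<in>UNIV. M * pmf (map_pmf snd P) y *
      measure_pmf.prob W {w. fst w = u \<and> fst (snd w) = x})"
    by (intro sum_mono markov_chain_pmf_le assms)
  \<comment> \<open>The factor \<open>M P(y)\<close> is free of \<open>x\<close>, so what remains is
    a sum over the disjoint events \<open>U = u, X = x\<close>, whose union is
    \<open>U = u\<close>.\<close>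
  also have "\<dots> = M * pmf (map_pmf snd P) y *
      measure_pmf.prob W (\<Union>x. {w. fst w = u \<and> fst (snd w) = x})"
    unfolding sum_distrib_left[symmetric]
    by (subst measure_pmf.finite_measure_finite_Union) (auto simp: disjoint_family_on_def)
  also have "(\<Union>x. {w. fst w = u \<and> fst (snd w) = x}) = fst -` {u}"
    by auto
  finally show ?thesis by (simp add: pmf_map)
qed

text \<open>Each posterior \<open>P(u|y)\<close> is at most \<open>M P(u)\<close>, hence at most
  \<open>M\<close> times the largest prior, and so is the maximum over \<open>u\<close> and
  \<open>y\<close>.\<close>

lemma realization_leakage_le:
  fixes P :: "('x::finite \<times> 'y::finite) pmf"
  assumes AW: "(A, W) \<in> realizations P"
    and M0: "0 \<le> M"
    and M: "\<And>x y. pmf P (x, y) \<le> M * (pmf (map_pmf fst P) x * pmf (map_pmf snd P) y)"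
  shows "ln ((MAX y \<in> {y. pmf (map_pmf snd P) y > 0}.
           MAX u \<in> A. \<P>((u', x', y') in measure_pmf W. u' = u \<bar> y' = y)) /
        (MAX u \<in> A. pmf (map_pmf fst W) u)) \<le> ln M"
proof -
  from AW have fin: "finite A" and sub: "fst ` set_pmf W \<subseteq> A"
    and marg: "map_pmf snd W = P"
    and markov: "markov_chain W fst (\<lambda>(u, x, y). x) (\<lambda>(u, x, y). y)"
    by (auto simp: realizations_def)
  let ?S = "{y. pmf (map_pmf snd P) y > 0}"
  let ?q = "\<lambda>u y. measure_pmf.prob W {w. fst w = u \<and> snd (snd w) = y} / pmf (map_pmf snd P) y"
  let ?D = "MAX u \<in> A. pmf (map_pmf fst W) u"
  let ?N = "MAX y \<in> ?S. MAX u \<in> A. ?q u y"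
  \<comment> \<open>One support point shows that both maxima range over nonempty sets and are
    positive, which the division and the monotonicity of \<open>ln\<close> require.\<close>
  obtain u x y where w: "(u, x, y) \<in> set_pmf W"
    by (metis prod_cases3 ex_in_conv set_pmf_not_empty)
  then have u: "u \<in> A"
    using sub by force
  have "y \<in> set_pmf (map_pmf snd P)"
    using w by (force simp: marg[symmetric])
  then have y: "y \<in> ?S"
    by (simp add: pmf_positive)
  have "u \<in> set_pmf (map_pmf fst W)"
    using w by force
  then have "0 < pmf (map_pmf fst W) u"
    by (rule pmf_positive)
  also have "\<dots> \<le> ?D"
    using fin u by simp
  finally have D: "0 < ?D" .
  have "0 < pmf W (u, x, y)"
    using w by (rule pmf_positive)
  also have "\<dots> = measure_pmf.prob W {(u, x, y)}"
    by (simp add: measure_pmf_single)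
  also have "\<dots> \<le> measure_pmf.prob W {w. fst w = u \<and> snd (snd w) = y}"
    by (rule measure_pmf.finite_measure_mono) auto
  finally have "0 < ?q u y"
    using y by simp
  also have "?q u y \<le> (MAX u \<in> A. ?q u y)"
    using fin u by (intro Max_ge) auto
  also have "\<dots> \<le> ?N"
    using y by (intro Max_ge) auto
  finally have N: "0 < ?N" .
  have q_le: "?q u y \<le> M * ?D" if "u \<in> A" "y \<in> ?S" for u y
  proof -
    have "?q u y \<le> M * pmf (map_pmf fst W) u"
      using markov_chain_prob_le[OF marg markov M, of u y] that
      by (simp add: field_simps)
    also have "\<dots> \<le> M * ?D"
      using fin that M0 by (intro mult_left_mono Max_ge) auto
    finally show ?thesis .
  qed
  have "?N \<le> M * ?D"
    using fin u y q_le by (intro Max.boundedI; fastforce intro!: Max.boundedI)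
  then have "?N / ?D \<le> M"
    using D by (simp add: field_simps)
  moreover have "0 < ?N / ?D"
    using N D by simp
  ultimately show ?thesis
    by (simp add: cond_prob_fst_thd_pmf marg)
qed

section \<open>Markov chains built from a kernel\<close>

text \<open>The joint law of \<open>(U, X, Y)\<close> when \<open>(X, Y)\<close> follows
  \<open>P\<close> and \<open>U\<close> is then drawn through the channel \<open>K\<close> from
  \<open>X\<close> alone.\<close>

definition kernel_join :: "('x \<times> 'y) pmf \<Rightarrow> ('x \<Rightarrow> 'u pmf) \<Rightarrow> ('u \<times> 'x \<times> 'y) pmf" where
  "kernel_join P K = bind_pmf P (\<lambda>v. map_pmf (\<lambda>u. (u, v)) (K (fst v)))"

lemma map_snd_kernel_join: "map_pmf snd (kernel_join P K) = P"
  by (simp add: kernel_join_def map_bind_pmf pmf.map_comp o_def map_pmf_const bind_return_pmf')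

lemma set_kernel_join: "set_pmf (kernel_join P K) = {(u, x, y). (x, y) \<in> set_pmf P \<and> u \<in> set_pmf (K x)}"
  by (auto simp: kernel_join_def)

lemma map_fst_kernel_join: "map_pmf fst (kernel_join P K) = bind_pmf (map_pmf fst P) K"
  by (simp add: kernel_join_def map_bind_pmf pmf.map_comp o_def bind_map_pmf)

text \<open>A general \<open>B\<close> lets one formula cover conditions on \<open>X\<close>, on
  \<open>Y\<close> and on the pair.\<close>

lemma prob_kernel_join:
  fixes P :: "('x::finite \<times> 'y::finite) pmf"
  shows "measure_pmf.prob (kernel_join P K) {w. fst w = u \<and> snd w \<in> B} =
    (\<Sum>v\<in>B. pmf P v * pmf (K (fst v)) u)"
proof -
  have pmf: "pmf (kernel_join P K) (u, v) = pmf P v * pmf (K (fst v)) u" for v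
  proof -
    \<comment> \<open>The second component is the constant \<open>v'\<close>, so only
      \<open>v' = v\<close> contributes to the mixture.\<close>
    have "pmf (map_pmf (\<lambda>u. (u, v')) (K (fst v'))) (u, v) =
        indicator {v} v' * pmf (K (fst v)) u" for v'
    proof (cases "v' = v")
      case True
      then show ?thesis
        using pmf_map_inj'[of "\<lambda>u. (u, v)" "K (fst v)" u] by (simp add: inj_on_def)
    next
      case False
      then show ?thesis by (auto simp: pmf_eq_0_set_pmf)
    qed
    then show ?thesis
      by (simp add: kernel_join_def pmf_bind measure_pmf_single)
  qed
  have "{w. fst w = u \<and> snd w \<in> B} = Pair u ` B"
    by force
  then show ?thesis
    by (simp add: measure_measure_pmf_finite sum.reindex inj_on_def pmf)
qed

text \<open>Given \<open>X = x\<close> and \<open>Y = y\<close>, the law of \<open>U\<close> is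
  \<open>K x\<close>, which does not depend on \<open>y\<close>.\<close>

lemma markov_chain_kernel_join:
  fixes P :: "('x::finite \<times> 'y::finite) pmf"
  shows "markov_chain (kernel_join P K) fst (\<lambda>(u, x, y). x) (\<lambda>(u, x, y). y)"
  unfolding markov_chain_def
proof (intro allI impI)
  fix u and x :: 'x and y :: 'y
  let ?W = "kernel_join P K"
  let ?X = "\<lambda>(u, x, y). x" and ?Y = "\<lambda>(u, x, y). y"
  have X: "\<P>(w in measure_pmf ?W. ?X w = x) = pmf (map_pmf fst P) x"
    by (subst map_snd_kernel_join[of P K, symmetric]) (simp add: pmf_map vimage_def case_prod_beta)
  have XY: "\<P>(w in measure_pmf ?W. ?Y w = y \<and> ?X w = x) = pmf P (x, y)"
    by (subst (2) map_snd_kernel_join[of P K, symmetric], unfold pmf_map)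
      (rule arg_cong[where f = "measure_pmf.prob ?W"], auto)
  have UX: "\<P>(w in measure_pmf ?W. fst w = u \<and> ?X w = x) = pmf (map_pmf fst P) x * pmf (K x) u"
    using prob_kernel_join[of P K u "{v. fst v = x}"]
    by (simp add: case_prod_beta pmf_map vimage_def measure_measure_pmf_finite sum_distrib_right)
  have UXY: "\<P>(w in measure_pmf ?W. (fst w = u \<and> ?Y w = y) \<and> ?X w = x) = pmf P (x, y) * pmf (K x) u"
    using prob_kernel_join[of P K u "{(x, y)}"]
    by (simp add: case_prod_beta prod_eq_iff conj_ac)
  assume "0 < \<P>(w in measure_pmf ?W. ?X w = x)"
  then show "\<P>(w in measure_pmf ?W. fst w = u \<and> ?Y w = y \<bar> ?X w = x) =
      \<P>(w in measure_pmf ?W. fst w = u \<bar> ?X w = x) * \<P>(w in measure_pmf ?W. ?Y w = y \<bar> ?X w = x)"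
    using X XY UX UXY by (simp add: cond_prob_def)
qed

text \<open>The event \<open>U = 0\<close> coincides with \<open>X = x\<close>, so observing
  \<open>y\<close> multiplies its probability by exactly the quotient on the left. The denominator
  of the leakage is \<open>P(x)\<close> once no other value of \<open>U\<close> is more likely than
  \<open>0\<close>.\<close>

lemma exists_realization_leakage_ge:
  fixes P :: "('x::finite \<times> 'y::finite) pmf"
  assumes pos: "pmf P (x, y) > 0"
  shows "\<exists>(A, W) \<in> realizations P.
    ln (pmf P (x, y) / (pmf (map_pmf fst P) x * pmf (map_pmf snd P) y)) \<le>
    ln ((MAX y \<in> {y. pmf (map_pmf snd P) y > 0}.
           MAX u \<in> A. \<P>((u', x', y') in measure_pmf W. u' = u \<bar> y' = y)) /
        (MAX u \<in> A. pmf (map_pmf fst W) u))"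
proof -
  let ?px = "pmf (map_pmf fst P) x" and ?py = "pmf (map_pmf snd P) y"
  have "(x, y) \<in> set_pmf P"
    using pos by (simp add: set_pmf_iff)
  then have px: "0 < ?px" and py: "0 < ?py"
    by (force intro!: pmf_positive)+
  obtain n :: nat where n: "1 / real (Suc n) < ?px"
    using px nat_approx_posE by (metis)
  \<comment> \<open>The range up to \<open>Suc n\<close> is nonempty, as \<open>pmf_of_set\<close>
    needs, and each of its values has conditional probability at most
    \<open>1 / Suc n < P(x)\<close>.\<close>
  define K where "K x' = (if x' = x then return_pmf 0 else pmf_of_set {1..Suc n})" for x'
  define W where "W = kernel_join P K"
  define A where "A = {..Suc n}"
  have "u \<le> Suc n" if "u \<in> set_pmf (K x')" for u x'
    using that by (auto simp: K_def split: if_splits)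
  then have AW: "(A, W) \<in> realizations P"
    unfolding realizations_def W_def
    by (auto simp: set_kernel_join map_snd_kernel_join markov_chain_kernel_join A_def)
  have U0: "pmf (map_pmf fst W) 0 = ?px"
  proof -
    have "pmf (K x') 0 = indicator {x} x'" for x'
      by (simp add: K_def)
    then show ?thesis
      by (simp add: W_def map_fst_kernel_join pmf_bind measure_pmf_single)
  qed
  have Ule: "pmf (map_pmf fst W) u \<le> ?px" for u
  proof (cases "u = 0")
    case False
    have "pmf (K x') u \<le> 1 / real (Suc n)" for x'
      using False by (simp add: K_def indicator_def)
    then have "pmf (map_pmf fst W) u \<le> (\<integral>x'. 1 / real (Suc n) \<partial>measure_pmf (map_pmf fst P))"
      unfolding W_def map_fst_kernel_join pmf_bind
      by (intro integral_mono measure_pmf.integrable_const_bound[where B = 1])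
        (auto simp: pmf_le_1)
    then show ?thesis
      using n by simp
  qed (simp add: U0)
  have D: "(MAX u \<in> A. pmf (map_pmf fst W) u) = ?px"
    using U0 Ule by (intro Max_eqI) (auto simp: A_def image_iff intro!: bexI[of _ 0])
  let ?q = "\<lambda>u y. \<P>((u', x', y') in measure_pmf W. u' = u \<bar> y' = y)"
  have "{w::nat \<times> 'x \<times> 'y. fst w = 0 \<and> snd (snd w) = y} = {w. fst w = 0 \<and> snd w \<in> {v. snd v = y}}"
    by auto
  then have "measure_pmf.prob W {w. fst w = 0 \<and> snd (snd w) = y} =
      (\<Sum>v | snd v = y. pmf P v * pmf (K (fst v)) 0)"
    unfolding W_def by (simp only: prob_kernel_join)
  \<comment> \<open>The other terms are zero, but a lower bound is enough.\<close>
  also have "\<dots> \<ge> (\<Sum>v\<in>{(x, y)}. pmf P v * pmf (K (fst v)) 0)"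
    by (rule sum_mono2) auto
  finally have "pmf P (x, y) / ?py \<le> ?q 0 y"
    using py by (simp add: cond_prob_fst_thd_pmf W_def map_snd_kernel_join K_def field_simps)
  also have "?q 0 y \<le> (MAX u \<in> A. ?q u y)"
    by (intro Max_ge) (auto simp: A_def)
  also have "\<dots> \<le> (MAX y \<in> {y. pmf (map_pmf snd P) y > 0}. MAX u \<in> A. ?q u y)"
    using py by (intro Max_ge) auto
  finally have "pmf P (x, y) / ?py / ?px \<le>
      (MAX y \<in> {y. pmf (map_pmf snd P) y > 0}. MAX u \<in> A. ?q u y) / ?px"
    using px by (intro divide_right_mono) auto
  moreover have "0 < pmf P (x, y) / ?py / ?px"
    using pos px py by simp
  ultimately have "ln (pmf P (x, y) / ?py / ?px) \<le>
      ln ((MAX y \<in> {y. pmf (map_pmf snd P) y > 0}. MAX u \<in> A. ?q u y) / ?px)"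
    by simp
  then show ?thesis
    using AW by (intro bexI[of _ "(A, W)"]) (simp_all add: D mult.commute)
qed

section \<open>Equality of the three quantities\<close>

theorem theorem13:
  fixes P :: "('x::finite \<times> 'y::finite) pmf"
  shows "maximal_realizable_leakage P =
           ereal (MAX (x, y) \<in> {(x, y). pmf P (x, y) > 0}.
             ln (\<P>((x', y') in measure_pmf P. y' = y \<bar> x' = x) / pmf (map_pmf snd P) y))
       \<and> ereal (MAX (x, y) \<in> {(x, y). pmf P (x, y) > 0}.
             ln (\<P>((x', y') in measure_pmf P. y' = y \<bar> x' = x) / pmf (map_pmf snd P) y)) =
           renyi_divergence_infinity P (pair_pmf (map_pmf fst P) (map_pmf snd P))"
proof -
  let ?Q = "pair_pmf (map_pmf fst P) (map_pmf snd P)"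
  let ?S = "{v. pmf P v > 0}"
  define r where "r v = pmf P v / pmf ?Q v" for v
  \<comment> \<open>\<open>P\<close> is absolutely continuous with respect to the product of its
    marginals, so no quotient is infinite and \<open>ennreal\<close> division agrees with real
    division on \<open>?S\<close>.\<close>
  have Q: "pmf ?Q v > 0" if "v \<in> ?S" for v
  proof -
    have "v \<in> set_pmf P"
      using that by (simp add: set_pmf_iff)
    then have "v \<in> set_pmf ?Q"
      by (cases v) force
    then show ?thesis
      by (rule pmf_positive)
  qed
  have r_pos: "0 < r v" if "v \<in> ?S" for v
    using Q[OF that] that by (simp add: r_def)
  have ne: "?S \<noteq> {}"
    using set_pmf_not_empty[of P] pmf_positive[of _ P] by blast
  \<comment> \<open>A maximiser \<open>v\<close> of the density \<open>r\<close> is fixed; all three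
    quantities are shown to equal \<open>ln (r v)\<close>.\<close>
  have "Max (r ` ?S) \<in> r ` ?S"
    using ne by (intro Max_in) auto
  then obtain v where v: "v \<in> ?S" and rv: "r v = Max (r ` ?S)"
    by auto
  then have r_le: "r v' \<le> r v" if "v' \<in> ?S" for v'
    using that by (simp only: rv) (rule Max_ge, auto)
  obtain x y where xy: "v = (x, y)"
    by (cases v)
  have "(MAX (x, y) \<in> {(x, y). pmf P (x, y) > 0}.
      ln (\<P>((x', y') in measure_pmf P. y' = y \<bar> x' = x) / pmf (map_pmf snd P) y)) =
      (MAX v \<in> ?S. ln (r v))"
    by (rule arg_cong[where f = Max], rule image_cong)
      (auto simp: cond_prob_pair_pmf r_def pmf_pair)
  also have "\<dots> = ln (r v)"
  proof (rule Max_eqI)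
    fix z assume "z \<in> (\<lambda>v. ln (r v)) ` ?S"
    then obtain v' where v': "v' \<in> ?S" and z: "z = ln (r v')"
      by blast
    show "z \<le> ln (r v)"
      using r_le[OF v'] r_pos[OF v'] r_pos[OF v] by (simp add: z)
  qed (use v in auto)
  finally have max: "(MAX (x, y) \<in> {(x, y). pmf P (x, y) > 0}.
      ln (\<P>((x', y') in measure_pmf P. y' = y \<bar> x' = x) / pmf (map_pmf snd P) y)) = ln (r v)" .
  have "(SUP a \<in> ?S. ennreal (pmf P a) / ennreal (pmf ?Q a)) = ennreal (r v)"
  proof (rule antisym)
    show "(SUP a \<in> ?S. ennreal (pmf P a) / ennreal (pmf ?Q a)) \<le> ennreal (r v)"
    proof (rule SUP_least)
      fix a assume "a \<in> ?S"
      then show "ennreal (pmf P a) / ennreal (pmf ?Q a) \<le> ennreal (r v)"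
        using r_le[of a] Q[of a] by (simp add: divide_ennreal r_def ennreal_leI)
    qed
    show "ennreal (r v) \<le> (SUP a \<in> ?S. ennreal (pmf P a) / ennreal (pmf ?Q a))"
      using v Q[OF v] by (intro SUP_upper2[of v]) (simp_all add: divide_ennreal r_def)
  qed
  then have renyi: "renyi_divergence_infinity P ?Q = ereal (ln (r v))"
    using r_pos[OF v] by (simp add: renyi_divergence_infinity_def log_ennreal_def)
  \<comment> \<open>The upper bound sums over all \<open>x\<close>, so the inequality must also
    cover pairs outside the support, where the left side is zero.\<close>
  have le: "pmf P (x', y') \<le> r v * (pmf (map_pmf fst P) x' * pmf (map_pmf snd P) y')" for x' y'
  proof (cases "(x', y') \<in> ?S")
    case True
    then show ?thesis
      using r_le[OF True] Q[OF True] by (simp add: r_def pmf_pair pos_divide_le_eq)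
  next
    case False
    then have "pmf P (x', y') \<le> 0"
      by (simp add: not_less del: pmf_le_0_iff)
    also have "\<dots> \<le> r v * (pmf (map_pmf fst P) x' * pmf (map_pmf snd P) y')"
      using r_pos[OF v] by simp
    finally show ?thesis .
  qed
  have "maximal_realizable_leakage P = ereal (ln (r v))"
  proof (rule antisym)
    show "maximal_realizable_leakage P \<le> ereal (ln (r v))"
      unfolding maximal_realizable_leakage_def
      by (rule SUP_least) (use r_pos[OF v] in \<open>auto intro!: realization_leakage_le le\<close>)
    have "0 < pmf P (x, y)"
      using v xy by simp
    then show "ereal (ln (r v)) \<le> maximal_realizable_leakage P"
      unfolding maximal_realizable_leakage_def
      using exists_realization_leakage_ge[of P x y]
      by (auto intro!: SUP_upper2 simp: r_def xy pmf_pair)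
  qed
  then show ?thesis
    using max renyi by simp
qed

end
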